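(* Under the standing assumptions on the data given in the context, define functions $W_n$ on $\mathcal P_2((E\times F)^{n+1})$, $n=0,\dots,T$, by $$W_T(\mu)=\Gamma(\mu),\qquad \mu\in\mathcal P_2((E\times F)^{T+1}),$$ and, for $n=0,\dots,T-1$, $$W_n(\mu)=\inf_{a_n\in\tilde{\mathfrak C}_n(\mu)}\Big\{C_n(\mu,a_n)+W_{n+1}\big(\bar P^{a_n}_{n+1}\mu\big)\Big\},\qquad \mu\in\mathcal P_2((E\times F)^{n+1}).$$ Then $W_n=V_n$ for every $n=0,\dots,T$. Suppose moreover that for every $n=0,\dots,T-1$ and every $\mu\in\mathcal P_2((E\times F)^{n+1})$ there exists $a_n^{\mu,*}\in\tilde{\mathfrak C}_n(\mu)$ such that $$W_n(\mu)=C_n(\mu,a_n^{\mu,*})+W_{n+1}\big(\bar P^{a_n^{\mu,*}}_{n+1}\mu\big).$$ Then, for any starting measure $\mu\in\mathcal P_2(E\times F)$, the strategy $a^*=(a^*_n)_{0\le n\le T-1}$ defined recursively by $a^*_0=a_0^{\mu,*}$ and $a^*_n=a_n^{M,*}$ with $M=M_n^{0,\mu,a^*}$, $n=1,\dots,T-1$, is optimal: $V_0(\mu)=\bar J_0(\mu,a^* )$.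
   Context: Spaces and data. $E=\mathbb R^p$, $F=\mathbb R^{p'}$, $C=\mathbb R^{p''}$ with $p,p',p''\ge 1$, and $T\ge 1$ is an integer horizon. $\mathcal P_2(S)$ denotes the Borel probability measures on $S$ with finite second moment and $\mathcal W_2$ the 2-Wasserstein distance. $(\varepsilon_n)_{1\le n\le T}$ are i.i.d. square integrable $\mathbb R^d$-valued random variables; $(\eta_n)_{1\le n\le T}$ are i.i.d. square integrable $\mathbb R^{d'}$-valued random variables, independent of $(\varepsilon_n)$. For $1\le n\le T$, $G_n:E\times\mathcal P_2(E)\times C\times\mathbb R^d\to E$ and $H_n:E\times F\times C\times\mathbb R^{d'}\to F$ are measurable. (They define the hidden and observed dynamics $X_{n+1}=G_{n+1}(X_n,\mathbb P_{X_n},\alpha_n,\varepsilon_{n+1})$, $Y_{n+1}=H_{n+1}(X_{n+1},Y_n,\alpha_n,\eta_{n+1})$, with controls $\alpha_n=a_n(Y_0,\dots,Y_n)$.) The functions $c_n:E\times\mathcal P_2(E)\times C\to\mathbb R$ ($0\le n\le T-1$) and $\gamma:E\times\mathcal P_2(E)\to\mathbb R$ are measurable. Standing assumptions. There is a constant $K$ such that for all arguments $|G_n(x,\mu,a,e)|^2\le K(1+|x|^2+\mathcal W_2(\mu,\delta_0)^2+|a|^2+|e|^2)$ and $|H_n(x,y,a,e)|^2\le K(1+|x|^2+|y|^2+|a|^2+|e|^2)$ for $1\le n\le T$; $|c_n(x,\mu,a)|\le K(1+|x|^2+\mathcal W_2(\mu,\delta_0)^2+|a|^2)$ for $0\le n\le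 T-1$; $|\gamma(x,\mu)|\le K(1+|x|^2+\mathcal W_2(\mu,\delta_0)^2)$. Moreover, for all $1\le k\le T$ and $(x,y,a)\in E\times F\times C$, the random variable $H_k(x,y,a,\eta_k)$ has a Lebesgue density $e\mapsto h_k(x,y,a,e)$ on $F$, with $h_k$ jointly measurable. Notation. $x_{0:n}=(x_0,\dots,x_n)$. For $M\in\mathcal P_2((E\times F)^{n+1})$ and $0\le\ell\le n$, ${}_\ell M$ is the marginal law of the $\ell$-th pair $(x_\ell,y_\ell)$, and ${}^1_\ell M$, ${}^2_\ell M$ are its marginals on $E$ and $F$ (laws of $x_\ell$ and $y_\ell$). Controls. For $\mu\in\mathcal P_2((E\times F)^{k+1})$, $\tilde{\mathfrak C}_k(\mu)$ is the set of measurable $a_k:F^{k+1}\to C$ with $\int|a_k(y_{0:k})|^2\,d\mu(x_{0:k},y_{0:k})<\infty$. Transitions. $P^u_k(x,\mu,dx')$ is the law of $G_k(x,\mu,u,\varepsilon_k)$. For $0\le n\le T-1$, $\mu\in\mathcal P_2((E\times F)^{n+1})$, $a_n\in\tilde{\mathfrak C}_n(\mu)$, the measure $\bar P^{a_n}_{n+1}\mu\in\mathcal P_2((E\times F)^{n+2})$ is $$\bar P^{a_n}_{n+1}\mu(dx_{0:n+1},dy_{0:n+1})=P^{a_n(y_{0:n})}_{n+1}(x_n,{}^1_n\mu,dx_{n+1})\,h_{n+1}(x_{n+1},y_n,a_n(y_{0:n}),y_{n+1})\,dy_{n+1}\,\mu(dx_{0:n},dy_{0:n}).$$ Costs. $C_n(M,a_n)=\int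 c_n(x_n,{}^1_nM,a_n(y_{0:n}))\,dM(x_{0:n},y_{0:n})$ for $M\in\mathcal P_2((E\times F)^{n+1})$, $a_n\in\tilde{\mathfrak C}_n(M)$; $\Gamma(M)=\int\gamma(x_T,{}^1_TM)\,dM(x_{0:T},y_{0:T})$ for $M\in\mathcal P_2((E\times F)^{T+1})$. Value functions. For $\mu\in\mathcal P_2((E\times F)^{n+1})$ and $a=(a_k)_{0\le k\le T-1}$, set $M^{n,\mu,a}_n=\mu$, $M^{n,\mu,a}_{k+1}=\bar P^{a_k}_{k+1}M^{n,\mu,a}_k$ for $n\le k\le T-1$ (so $M^{n,\mu,a}_k$ depends only on $a_n,\dots,a_{k-1}$). ${}_n\tilde{\mathfrak C}(\mu)$ is the set of such $a$ with $a_k\in\tilde{\mathfrak C}_k(M^{n,\mu,a}_k)$ for $k=n,\dots,T-1$ (the components $a_k$, $k<n$, play no role). Then $$\bar J_n(\mu,a)=\sum_{k=n}^{T-1}C_k(M^{n,\mu,a}_k,a_k)+\Gamma(M^{n,\mu,a}_T),\qquad V_n(\mu)=\inf_{a\in{}_n\tilde{\mathfrak C}(\mu)}\bar J_n(\mu,a),$$ so $V_T=\Gamma$. Infima are understood in $[-\infty,\infty)$. *)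

theory Defs
  imports "HOL-Probability.Probability"
begin

section \<open>Wasserstein space\<close>

definition P2 :: "'a::euclidean_space measure set" where
  "P2 = {\<mu>. prob_space \<mu> \<and> sets \<mu> = sets borel \<and> integrable \<mu> (\<lambda>x. (norm x)\<^sup>2)}"

definition couplings ::
  "'a::euclidean_space measure \<Rightarrow> 'a measure \<Rightarrow> ('a \<times> 'a) measure set" where
  "couplings \<mu> \<nu> = {\<pi>. prob_space \<pi> \<and> sets \<pi> = sets (borel \<Otimes>\<^sub>M borel)
     \<and> distr \<pi> borel fst = \<mu> \<and> distr \<pi> borel snd = \<nu>}"

definition W2 :: "'a::euclidean_space measure \<Rightarrow> 'a measure \<Rightarrow> real" where
  "W2 \<mu> \<nu> = sqrt (INF \<pi>\<in>couplings \<mu> \<nu>. \<integral>p. (dist (fst p) (snd p))\<^sup>2 \<partial>\<pi>)"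

text \<open>The Borel \<open>\<sigma>\<close>-algebra of the metric space \<^term>\<open>P2\<close> with distance \<^const>\<open>W2\<close>:
  the generators are the \<^const>\<open>W2\<close>-open subsets.\<close>

definition P2_borel :: "'a::euclidean_space measure measure" where
  "P2_borel = sigma P2 {U. U \<subseteq> P2 \<and> (\<forall>\<mu>\<in>U. \<exists>r>0. \<forall>\<nu>\<in>P2. W2 \<mu> \<nu> < r \<longrightarrow> \<nu> \<in> U)}"


section \<open>Laws of trajectories\<close>

text \<open>The space \<open>(E \<times> F)\<^sup>n\<^sup>+\<^sup>1\<close> is the product over the index set \<open>{0, \<dots>, n}\<close>; a trajectory is a
  function \<open>z\<close> with \<open>z i = (x\<^sub>i, y\<^sub>i)\<close> for \<open>i \<le> n\<close>.\<close>

abbreviation path_space :: "nat \<Rightarrow> (nat \<Rightarrow> 'a::euclidean_space) measure" where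
  "path_space n \<equiv> PiM {..n} (\<lambda>_. borel)"

definition P2_path :: "nat \<Rightarrow> (nat \<Rightarrow> 'e::euclidean_space \<times> 'f::euclidean_space) measure set" where
  "P2_path n = {M. prob_space M \<and> sets M = sets (path_space n)
     \<and> integrable M (\<lambda>z. \<Sum>i\<le>n. (norm (z i))\<^sup>2)}"

definition obs :: "nat \<Rightarrow> (nat \<Rightarrow> 'e \<times> 'f) \<Rightarrow> (nat \<Rightarrow> 'f)" where
  "obs n z = (\<lambda>i\<in>{..n}. snd (z i))"

definition marg1 :: "nat \<Rightarrow> (nat \<Rightarrow> 'e::euclidean_space \<times> 'f) measure \<Rightarrow> 'e measure" where
  "marg1 l M = distr M borel (\<lambda>z. fst (z l))"

definition controls ::
  "nat \<Rightarrow> (nat \<Rightarrow> 'e::euclidean_space \<times> 'f::euclidean_space) measure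
    \<Rightarrow> ((nat \<Rightarrow> 'f) \<Rightarrow> 'c::euclidean_space) set" where
  "controls k \<mu> = {a. a \<in> borel_measurable (path_space k)
     \<and> integrable \<mu> (\<lambda>z. (norm (a (obs k z)))\<^sup>2)}"


section \<open>Data and standing assumptions\<close>

record ('e, 'f, 'c, 'd, 'm, 'w) control_problem =
  horizon :: nat
  noise_space :: "'w measure"
  eps :: "nat \<Rightarrow> 'w \<Rightarrow> 'd"
  eta :: "nat \<Rightarrow> 'w \<Rightarrow> 'm"
  G_map :: "nat \<Rightarrow> 'e \<Rightarrow> 'e measure \<Rightarrow> 'c \<Rightarrow> 'd \<Rightarrow> 'e"
  H_map :: "nat \<Rightarrow> 'e \<Rightarrow> 'f \<Rightarrow> 'c \<Rightarrow> 'm \<Rightarrow> 'f"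
  h_dens :: "nat \<Rightarrow> 'e \<Rightarrow> 'f \<Rightarrow> 'c \<Rightarrow> 'f \<Rightarrow> real"
  run_cost :: "nat \<Rightarrow> 'e \<Rightarrow> 'e measure \<Rightarrow> 'c \<Rightarrow> real"
  end_cost :: "'e \<Rightarrow> 'e measure \<Rightarrow> real"

text \<open>In \<open>indep_eps_eta\<close> the two sets are the \<open>\<sigma>\<close>-algebras generated by the vectors
  \<open>(\<epsilon>\<^sub>1, \<dots>, \<epsilon>\<^sub>T)\<close> and \<open>(\<eta>\<^sub>1, \<dots>, \<eta>\<^sub>T)\<close>; \<^const>\<open>prob_space.indep_var\<close> does not apply, since it requires
  both variables to have the same codomain.\<close>

locale control_model =
  fixes D :: "('e::euclidean_space, 'f::euclidean_space, 'c::euclidean_space,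
      'd::euclidean_space, 'm::euclidean_space, 'w) control_problem"
    and K :: real
  assumes horizon_pos: "1 \<le> horizon D"
    and prob_noise: "prob_space (noise_space D)"
    and indep_eps:
      "prob_space.indep_vars (noise_space D) (\<lambda>_. borel) (eps D) {1..horizon D}"
    and ident_eps: "\<And>n. n \<in> {1..horizon D} \<Longrightarrow>
      distr (noise_space D) borel (eps D n) = distr (noise_space D) borel (eps D 1)"
    and square_eps: "\<And>n. n \<in> {1..horizon D} \<Longrightarrow>
      integrable (noise_space D) (\<lambda>\<omega>. (norm (eps D n \<omega>))\<^sup>2)"
    and indep_eta:
      "prob_space.indep_vars (noise_space D) (\<lambda>_. borel) (eta D) {1..horizon D}"
    and ident_eta: "\<And>n. n \<in> {1..horizon D} \<Longrightarrow>
      distr (noise_space D) borel (eta D n) = distr (noise_space D) borel (eta D 1)"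
    and square_eta: "\<And>n. n \<in> {1..horizon D} \<Longrightarrow>
      integrable (noise_space D) (\<lambda>\<omega>. (norm (eta D n \<omega>))\<^sup>2)"
    and indep_eps_eta:
      "prob_space.indep_set (noise_space D)
        (sets (vimage_algebra (space (noise_space D)) (\<lambda>\<omega>. \<lambda>n\<in>{1..horizon D}. eps D n \<omega>)
          (PiM {1..horizon D} (\<lambda>_. borel))))
        (sets (vimage_algebra (space (noise_space D)) (\<lambda>\<omega>. \<lambda>n\<in>{1..horizon D}. eta D n \<omega>)
          (PiM {1..horizon D} (\<lambda>_. borel))))"
    and G_measurable: "\<And>n. n \<in> {1..horizon D} \<Longrightarrow>
      (\<lambda>(x, \<mu>, u, e). G_map D n x \<mu> u e)
        \<in> borel_measurable (borel \<Otimes>\<^sub>M P2_borel \<Otimes>\<^sub>M borel \<Otimes>\<^sub>M borel)"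
    and H_measurable: "\<And>n. n \<in> {1..horizon D} \<Longrightarrow>
      (\<lambda>(x, y, u, e). H_map D n x y u e)
        \<in> borel_measurable (borel \<Otimes>\<^sub>M borel \<Otimes>\<^sub>M borel \<Otimes>\<^sub>M borel)"
    and run_cost_measurable: "\<And>n. n < horizon D \<Longrightarrow>
      (\<lambda>(x, \<mu>, u). run_cost D n x \<mu> u)
        \<in> borel_measurable (borel \<Otimes>\<^sub>M P2_borel \<Otimes>\<^sub>M borel)"
    and end_cost_measurable:
      "(\<lambda>(x, \<mu>). end_cost D x \<mu>) \<in> borel_measurable (borel \<Otimes>\<^sub>M P2_borel)"
    and G_growth: "\<And>n x \<mu> u e. n \<in> {1..horizon D} \<Longrightarrow> \<mu> \<in> P2 \<Longrightarrow>
      (norm (G_map D n x \<mu> u e))\<^sup>2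
        \<le> K * (1 + (norm x)\<^sup>2 + (W2 \<mu> (return borel 0))\<^sup>2 + (norm u)\<^sup>2 + (norm e)\<^sup>2)"
    and H_growth: "\<And>n x y u e. n \<in> {1..horizon D} \<Longrightarrow>
      (norm (H_map D n x y u e))\<^sup>2
        \<le> K * (1 + (norm x)\<^sup>2 + (norm y)\<^sup>2 + (norm u)\<^sup>2 + (norm e)\<^sup>2)"
    and run_cost_growth: "\<And>n x \<mu> u. n < horizon D \<Longrightarrow> \<mu> \<in> P2 \<Longrightarrow>
      \<bar>run_cost D n x \<mu> u\<bar>
        \<le> K * (1 + (norm x)\<^sup>2 + (W2 \<mu> (return borel 0))\<^sup>2 + (norm u)\<^sup>2)"
    and end_cost_growth: "\<And>x \<mu>. \<mu> \<in> P2 \<Longrightarrow>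
      \<bar>end_cost D x \<mu>\<bar> \<le> K * (1 + (norm x)\<^sup>2 + (W2 \<mu> (return borel 0))\<^sup>2)"
    and h_nonneg: "\<And>n x y u e. n \<in> {1..horizon D} \<Longrightarrow> 0 \<le> h_dens D n x y u e"
    and h_measurable: "\<And>n. n \<in> {1..horizon D} \<Longrightarrow>
      (\<lambda>(x, y, u, e). h_dens D n x y u e)
        \<in> borel_measurable (borel \<Otimes>\<^sub>M borel \<Otimes>\<^sub>M borel \<Otimes>\<^sub>M borel)"
    and h_density: "\<And>n x y u. n \<in> {1..horizon D} \<Longrightarrow>
      distributed (noise_space D) lborel (\<lambda>\<omega>. H_map D n x y u (eta D n \<omega>))
        (\<lambda>e. ennreal (h_dens D n x y u e))"


section \<open>Transitions, costs and value functions\<close>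

definition hidden_kernel ::
  "('e::euclidean_space, 'f, 'c, 'd, 'm, 'w) control_problem
    \<Rightarrow> nat \<Rightarrow> 'c \<Rightarrow> 'e \<Rightarrow> 'e measure \<Rightarrow> 'e measure" where
  "hidden_kernel D k u x \<mu> = distr (noise_space D) borel (\<lambda>\<omega>. G_map D k x \<mu> u (eps D k \<omega>))"

text \<open>\<open>next_law D n a \<mu>\<close> is \<open>P\<^sub>n\<^sub>+\<^sub>1\<^sup>a \<mu>\<close> (with a bar), for \<open>\<mu>\<close> on \<open>(E \<times> F)\<^sup>n\<^sup>+\<^sup>1\<close> and \<open>a\<close> the control at
  time \<open>n\<close>. The iterated kernel integral is written with the monadic bind of the Giry monad.\<close>

definition next_law ::
  "('e::euclidean_space, 'f::euclidean_space, 'c, 'd, 'm, 'w) control_problem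
    \<Rightarrow> nat \<Rightarrow> ((nat \<Rightarrow> 'f) \<Rightarrow> 'c) \<Rightarrow> (nat \<Rightarrow> 'e \<times> 'f) measure \<Rightarrow> (nat \<Rightarrow> 'e \<times> 'f) measure" where
  "next_law D n a \<mu> =
     \<mu> \<bind> (\<lambda>z.
       hidden_kernel D (Suc n) (a (obs n z)) (fst (z n)) (marg1 n \<mu>) \<bind> (\<lambda>x'.
         density lborel (\<lambda>y'. ennreal (h_dens D (Suc n) x' (snd (z n)) (a (obs n z)) y')) \<bind> (\<lambda>y'.
           return (path_space (Suc n)) (z(Suc n := (x', y'))))))"

definition stage_cost ::
  "('e::euclidean_space, 'f, 'c, 'd, 'm, 'w) control_problem
    \<Rightarrow> nat \<Rightarrow> (nat \<Rightarrow> 'e \<times> 'f) measure \<Rightarrow> ((nat \<Rightarrow> 'f) \<Rightarrow> 'c) \<Rightarrow> real" where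
  "stage_cost D n M a = (\<integral>z. run_cost D n (fst (z n)) (marg1 n M) (a (obs n z)) \<partial>M)"

definition terminal_cost ::
  "('e::euclidean_space, 'f, 'c, 'd, 'm, 'w) control_problem
    \<Rightarrow> (nat \<Rightarrow> 'e \<times> 'f) measure \<Rightarrow> real" where
  "terminal_cost D M =
     (\<integral>z. end_cost D (fst (z (horizon D))) (marg1 (horizon D) M) \<partial>M)"

text \<open>\<open>flow D n \<mu> a k\<close> is \<open>M\<^sub>k\<close> for initial time \<open>n\<close>, initial law \<open>\<mu>\<close> and strategy \<open>a\<close>, meaningful
  for \<open>k \<ge> n\<close>; it is \<open>\<mu>\<close> for \<open>k \<le> n\<close>.\<close>

primrec flow ::
  "('e::euclidean_space, 'f::euclidean_space, 'c, 'd, 'm, 'w) control_problem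
    \<Rightarrow> nat \<Rightarrow> (nat \<Rightarrow> 'e \<times> 'f) measure \<Rightarrow> (nat \<Rightarrow> (nat \<Rightarrow> 'f) \<Rightarrow> 'c)
    \<Rightarrow> nat \<Rightarrow> (nat \<Rightarrow> 'e \<times> 'f) measure" where
  "flow D n \<mu> a 0 = \<mu>"
| "flow D n \<mu> a (Suc k) = (if n \<le> k then next_law D k (a k) (flow D n \<mu> a k) else \<mu>)"

definition admissible ::
  "('e::euclidean_space, 'f::euclidean_space, 'c::euclidean_space, 'd, 'm, 'w) control_problem
    \<Rightarrow> nat \<Rightarrow> (nat \<Rightarrow> 'e \<times> 'f) measure \<Rightarrow> (nat \<Rightarrow> (nat \<Rightarrow> 'f) \<Rightarrow> 'c) set" where
  "admissible D n \<mu> = {a. \<forall>k\<in>{n..<horizon D}. a k \<in> controls k (flow D n \<mu> a k)}"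

definition J ::
  "('e::euclidean_space, 'f::euclidean_space, 'c, 'd, 'm, 'w) control_problem
    \<Rightarrow> nat \<Rightarrow> (nat \<Rightarrow> 'e \<times> 'f) measure \<Rightarrow> (nat \<Rightarrow> (nat \<Rightarrow> 'f) \<Rightarrow> 'c) \<Rightarrow> real" where
  "J D n \<mu> a = (\<Sum>k\<in>{n..<horizon D}. stage_cost D k (flow D n \<mu> a k) (a k))
     + terminal_cost D (flow D n \<mu> a (horizon D))"

definition V ::
  "('e::euclidean_space, 'f::euclidean_space, 'c::euclidean_space, 'd, 'm, 'w) control_problem
    \<Rightarrow> nat \<Rightarrow> (nat \<Rightarrow> 'e \<times> 'f) measure \<Rightarrow> ereal" where
  "V D n \<mu> = (INF a\<in>admissible D n \<mu>. ereal (J D n \<mu> a))"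

function W ::
  "('e::euclidean_space, 'f::euclidean_space, 'c::euclidean_space, 'd, 'm, 'w) control_problem
    \<Rightarrow> nat \<Rightarrow> (nat \<Rightarrow> 'e \<times> 'f) measure \<Rightarrow> ereal" where
  "W D n \<mu> =
     (if n < horizon D
      then INF a\<in>controls n \<mu>. ereal (stage_cost D n \<mu> a) + W D (Suc n) (next_law D n a \<mu>)
      else ereal (terminal_cost D \<mu>))"
  by pat_completeness auto
termination
  by (relation "Wellfounded.measure (\<lambda>(D, n, \<mu>). horizon D - n)") auto

declare W.simps [simp del]


section \<open>The strategy built from stagewise minimisers\<close>

lemma flow_cong [fundef_cong]:
  assumes "D = D'" "n = n'" "\<mu> = \<mu>'" "k = k'" "\<And>j. j < k' \<Longrightarrow> a j = a' j"
  shows "flow D n \<mu> a k = flow D' n' \<mu>' a' k'"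
proof -
  have "(\<And>j. j < i \<Longrightarrow> a j = a' j) \<Longrightarrow> flow D n \<mu> a i = flow D n \<mu> a' i" for i
    by (induction i) auto
  then show ?thesis using assms by simp
qed

text \<open>\<open>A n M\<close> plays the role of the minimiser \<open>a\<^sub>n\<^sup>M\<^sup>,\<^sup>*\<close>. The recursion is well founded because
  \<open>flow D 0 \<mu> a n\<close> only depends on \<open>a k\<close> for \<open>k < n\<close>.\<close>

function feedback_strategy ::
  "('e::euclidean_space, 'f::euclidean_space, 'c, 'd, 'm, 'w) control_problem
    \<Rightarrow> (nat \<Rightarrow> (nat \<Rightarrow> 'e \<times> 'f) measure \<Rightarrow> (nat \<Rightarrow> 'f) \<Rightarrow> 'c)
    \<Rightarrow> (nat \<Rightarrow> 'e \<times> 'f) measure \<Rightarrow> nat \<Rightarrow> (nat \<Rightarrow> 'f) \<Rightarrow> 'c" where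
  "feedback_strategy D A \<mu> n = A n (flow D 0 \<mu> (\<lambda>k. feedback_strategy D A \<mu> k) n)"
  by pat_completeness auto
termination
  by (relation "Wellfounded.measure (\<lambda>(D, A, \<mu>, n). n)") auto

declare feedback_strategy.simps [simp del]

end

theory Submission
  imports Defs
begin

text \<open>
  The state of the control problem at time \<open>n\<close> is the whole law of the trajectory, and it evolves
  deterministically. A strategy admissible from \<open>(n, \<mu>)\<close> is therefore the same thing as a
  control \<open>b\<close> at time \<open>n\<close> followed by a strategy admissible from \<open>(n + 1, next_law D n b \<mu>)\<close>, and
  the cost splits accordingly (\<open>admissible_restart\<close>, \<open>J_restart\<close>). Taking the infimum in two
  stages shows that the value functions satisfy the recursion that defines \<open>W\<close>
  (\<open>V_Bellman\<close>), and backward induction gives \<open>W = V\<close>. Stage costs are real numbers, so adding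
  one commutes with infima in the extended reals, even where the infimum is infinite.

  For the second assertion the costs along the feedback strategy telescope: each stage attains the
  infimum, so \<open>W D 0 \<mu>\<close> is the cost accumulated up to time \<open>n\<close> plus \<open>W D n\<close> at the current law
  (\<open>W_attained_along_flow\<close>). The minimisers are only given at laws with finite second moment,
  hence the flow must remain among these laws (\<open>next_law_in_P2_path\<close>). This is where
  probability enters: the transition is a composition of probability kernels, and the quadratic growth
  of \<open>G\<close> and \<open>H\<close> bounds the second moments of the new pair \<open>(x', y')\<close> given the past by a quadratic
  expression in the past state and the control, which is integrable.
\<close>

section \<open>Dynamic programming\<close>

lemma flow_before: "k \<le> n \<Longrightarrow> flow D n \<mu> a k = \<mu>"
  by (induction k) auto

lemma flow_restart:
  assumes "n < k"
  shows "flow D n \<mu> a k = flow D (Suc n) (next_law D n (a n) \<mu>) a k"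
  using assms
proof (induction k)
  case (Suc k)
  then show ?case
    by (cases "n = k") (auto simp: flow_before)
qed simp

lemma flow_cong_from:
  assumes "\<And>j. n \<le> j \<Longrightarrow> j < k \<Longrightarrow> a j = b j"
  shows "flow D n \<mu> a k = flow D n \<mu> b k"
  using assms by (induction k) auto

lemma J_restart:
  assumes "n < horizon D"
  shows "J D n \<mu> a = stage_cost D n \<mu> (a n) + J D (Suc n) (next_law D n (a n) \<mu>) a"
  using assms flow_restart[of n _ D \<mu> a]
  by (simp add: J_def sum.atLeast_Suc_lessThan flow_before)

lemma J_cong_from:
  assumes "\<And>j. n \<le> j \<Longrightarrow> j < horizon D \<Longrightarrow> a j = b j"
  shows "J D n \<mu> a = J D n \<mu> b"
proof -
  have "flow D n \<mu> a k = flow D n \<mu> b k" if "k \<le> horizon D" for k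
    using that assms by (intro flow_cong_from) auto
  then show ?thesis
    using assms by (simp add: J_def)
qed

lemma admissible_restart:
  assumes "n < horizon D"
  shows "a \<in> admissible D n \<mu> \<longleftrightarrow>
    a n \<in> controls n \<mu> \<and> a \<in> admissible D (Suc n) (next_law D n (a n) \<mu>)"
proof -
  have "{n..<horizon D} = insert n {Suc n..<horizon D}"
    using assms by auto
  then show ?thesis
    using flow_restart[of n _ D \<mu> a] by (simp add: admissible_def flow_before)
qed

lemma admissible_cong_from:
  assumes "\<And>j. n \<le> j \<Longrightarrow> j < horizon D \<Longrightarrow> a j = b j"
  shows "a \<in> admissible D n \<mu> \<longleftrightarrow> b \<in> admissible D n \<mu>"
proof -
  have "flow D n \<mu> a k = flow D n \<mu> b k" if "k < horizon D" for k
    using that assms by (intro flow_cong_from) auto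
  then show ?thesis
    using assms by (simp add: admissible_def)
qed

text \<open>Finiteness of \<open>c\<close> makes its addition invertible: the reverse inequality follows by subtracting it.\<close>

lemma ereal_add_INF:
  fixes f :: "'a \<Rightarrow> ereal"
  shows "ereal c + (INF x\<in>S. f x) = (INF x\<in>S. ereal c + f x)"
proof (rule antisym)
  show "ereal c + (INF x\<in>S. f x) \<le> (INF x\<in>S. ereal c + f x)"
    by (intro INF_greatest add_left_mono INF_lower)
  have "(INF x\<in>S. ereal c + f x) - ereal c \<le> (INF x\<in>S. f x)"
  proof (rule INF_greatest)
    fix x assume "x \<in> S"
    then have "(INF x\<in>S. ereal c + f x) \<le> ereal c + f x"
      by (rule INF_lower)
    then show "(INF x\<in>S. ereal c + f x) - ereal c \<le> f x"
      by (simp add: ereal_minus_le add.commute)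
  qed
  then show "(INF x\<in>S. ereal c + f x) \<le> ereal c + (INF x\<in>S. f x)"
    by (simp add: ereal_minus_le add.commute)
qed

text \<open>Pairs of a control at time \<open>n\<close> and a continuation correspond to strategies from time \<open>n\<close> by
  \<open>a(n := b)\<close>; overwriting component \<open>n\<close> does not disturb the continuation, whose cost and
  admissibility depend only on the components after \<open>n\<close>.\<close>

lemma V_Bellman:
  assumes n: "n < horizon D"
  shows "V D n \<mu> =
    (INF b\<in>controls n \<mu>. ereal (stage_cost D n \<mu> b) + V D (Suc n) (next_law D n b \<mu>))"
    (is "_ = (INF b\<in>_. ?R b)")
proof (rule antisym)
  show "V D n \<mu> \<le> (INF b\<in>controls n \<mu>. ?R b)"
  proof (rule INF_greatest)
    fix b :: "(nat \<Rightarrow> 'b) \<Rightarrow> 'c"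
    assume b: "b \<in> controls n \<mu>"
    have "V D n \<mu> \<le> ereal (stage_cost D n \<mu> b) + ereal (J D (Suc n) (next_law D n b \<mu>) a)"
      if a: "a \<in> admissible D (Suc n) (next_law D n b \<mu>)" for a
    proof -
      let ?a = "a(n := b)"
      have "?a \<in> admissible D n \<mu>"
        using a b admissible_cong_from[of "Suc n" D ?a a "next_law D n b \<mu>"]
        by (simp add: admissible_restart[OF n])
      then have "V D n \<mu> \<le> ereal (J D n \<mu> ?a)"
        unfolding V_def by (rule INF_lower)
      also have "J D n \<mu> ?a = stage_cost D n \<mu> b + J D (Suc n) (next_law D n b \<mu>) a"
        using J_cong_from[of "Suc n" D ?a a "next_law D n b \<mu>"]
        by (simp add: J_restart[OF n])
      finally show ?thesis by simp
    qed
    then show "V D n \<mu> \<le> ?R b"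
      unfolding V_def[of D "Suc n"] ereal_add_INF by (rule INF_greatest)
  qed
next
  show "(INF b\<in>controls n \<mu>. ?R b) \<le> V D n \<mu>"
    unfolding V_def[of D n]
  proof (rule INF_greatest)
    fix a assume "a \<in> admissible D n \<mu>"
    then have a: "a n \<in> controls n \<mu>" "a \<in> admissible D (Suc n) (next_law D n (a n) \<mu>)"
      by (auto simp: admissible_restart[OF n])
    have "(INF b\<in>controls n \<mu>. ?R b) \<le> ?R (a n)"
      using a(1) by (rule INF_lower)
    also have "\<dots> \<le> ereal (stage_cost D n \<mu> (a n))
        + ereal (J D (Suc n) (next_law D n (a n) \<mu>) a)"
      unfolding V_def by (intro add_left_mono INF_lower a(2))
    finally show "(INF b\<in>controls n \<mu>. ?R b) \<le> ereal (J D n \<mu> a)"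
      by (simp add: J_restart[OF n])
  qed
qed

lemma V_terminal: "V D (horizon D) \<mu> = ereal (terminal_cost D \<mu>)"
proof -
  have "admissible D (horizon D) \<mu> = UNIV"
    by (simp add: admissible_def)
  then show ?thesis
    by (simp add: V_def J_def flow_before)
qed

lemma W_eq_V:
  assumes "n \<le> horizon D"
  shows "W D n \<mu> = V D n \<mu>"
  using assms
proof (induction n arbitrary: \<mu> rule: inc_induct)
  case base
  show ?case
    by (simp add: W.simps V_terminal)
next
  case (step n)
  then show ?case
    by (simp add: W.simps[of D n] V_Bellman)
qed

lemma W_attained_along_flow:
  assumes "\<And>k. k < n \<Longrightarrow> W D k (flow D 0 \<mu> a k) =
      ereal (stage_cost D k (flow D 0 \<mu> a k) (a k)) + W D (Suc k) (flow D 0 \<mu> a (Suc k))"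
  shows "W D 0 \<mu> = ereal (\<Sum>k<n. stage_cost D k (flow D 0 \<mu> a k) (a k)) + W D n (flow D 0 \<mu> a n)"
  using assms
proof (induction n)
  case 0
  then show ?case by (simp add: zero_ereal_def[symmetric])
next
  case (Suc n)
  then show ?case
    by (simp add: add.assoc del: flow.simps plus_ereal.simps add: plus_ereal.simps(1)[symmetric])
qed

section \<open>Second moments\<close>

text \<open>For a random variable driven by a noise \<open>Y\<close>, the growth bound is integrated over the noise;
  \<open>c\<close> stands for the contribution of the state and the control, which are fixed here.\<close>

lemma nn_integral_square_distr_le:
  fixes X :: "'w \<Rightarrow> 'a::euclidean_space" and Y :: "'w \<Rightarrow> 'b::euclidean_space"
  assumes "prob_space N"
    and X: "X \<in> borel_measurable N"
    and Y: "integrable N (\<lambda>\<omega>. (norm (Y \<omega>))\<^sup>2)"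
    and le: "\<And>\<omega>. (norm (X \<omega>))\<^sup>2 \<le> K * (c + (norm (Y \<omega>))\<^sup>2)"
  shows "(\<integral>\<^sup>+ x. ennreal ((norm x)\<^sup>2) \<partial>distr N borel X)
    \<le> ennreal (K * (c + (\<integral>\<omega>. (norm (Y \<omega>))\<^sup>2 \<partial>N)))"
proof -
  interpret prob_space N by fact
  have "(\<integral>\<^sup>+ x. ennreal ((norm x)\<^sup>2) \<partial>distr N borel X) = (\<integral>\<^sup>+ \<omega>. ennreal ((norm (X \<omega>))\<^sup>2) \<partial>N)"
    using X by (intro nn_integral_distr) auto
  also have "\<dots> \<le> (\<integral>\<^sup>+ \<omega>. ennreal (K * (c + (norm (Y \<omega>))\<^sup>2)) \<partial>N)"
    using le by (intro nn_integral_mono ennreal_leI)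
  also have "\<dots> = ennreal (\<integral>\<omega>. K * (c + (norm (Y \<omega>))\<^sup>2) \<partial>N)"
    using Y order_trans[OF zero_le_power2 le] by (intro nn_integral_eq_integral) auto
  also have "(\<integral>\<omega>. K * (c + (norm (Y \<omega>))\<^sup>2) \<partial>N) = K * (c + (\<integral>\<omega>. (norm (Y \<omega>))\<^sup>2 \<partial>N))"
    using Y by (simp add: prob_space)
  finally show ?thesis .
qed

lemma nn_integral_affine_square_le:
  fixes P :: "'a::euclidean_space measure"
  assumes "prob_space P" and [measurable_cong]: "sets P = sets borel"
    and m: "(\<integral>\<^sup>+ x. ennreal ((norm x)\<^sup>2) \<partial>P) \<le> ennreal m"
    and "0 \<le> b" "0 \<le> c" "0 \<le> m"
  shows "(\<integral>\<^sup>+ x. ennreal (b + c * (norm x)\<^sup>2) \<partial>P) \<le> ennreal (b + c * m)"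
proof -
  interpret prob_space P by fact
  have "(\<integral>\<^sup>+ x. ennreal (b + c * (norm x)\<^sup>2) \<partial>P)
      = (\<integral>\<^sup>+ x. ennreal b + ennreal c * ennreal ((norm x)\<^sup>2) \<partial>P)"
    using assms(4-) by (intro nn_integral_cong) (simp add: ennreal_mult)
  also have "\<dots> = ennreal b + ennreal c * (\<integral>\<^sup>+ x. ennreal ((norm x)\<^sup>2) \<partial>P)"
    by (subst nn_integral_add) (auto simp: nn_integral_cmult emeasure_space_1)
  also have "\<dots> \<le> ennreal b + ennreal c * ennreal m"
    using m by (intro add_left_mono mult_left_mono) auto
  finally show ?thesis
    using assms(4-) by (simp add: ennreal_mult)
qed

lemma measurable_fst_coord [measurable]:
  assumes "i \<le> n"
  shows "(\<lambda>z. fst (z i)) \<in> borel_measurable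
    (path_space n :: (nat \<Rightarrow> 'a::euclidean_space \<times> 'b::euclidean_space) measure)"
  using assms by (intro measurable_compose[OF measurable_component_singleton]
      borel_measurable_continuous_onI continuous_on_fst continuous_on_id) auto

lemma measurable_snd_coord [measurable]:
  assumes "i \<le> n"
  shows "(\<lambda>z. snd (z i)) \<in> borel_measurable
    (path_space n :: (nat \<Rightarrow> 'a::euclidean_space \<times> 'b::euclidean_space) measure)"
  using assms by (intro measurable_compose[OF measurable_component_singleton]
      borel_measurable_continuous_onI continuous_on_snd continuous_on_id) auto

lemma measurable_obs [measurable]:
  "obs n \<in> (path_space n :: (nat \<Rightarrow> 'a::euclidean_space \<times> 'b::euclidean_space) measure)
    \<rightarrow>\<^sub>M path_space n"
  unfolding obs_def by (intro measurable_restrict measurable_snd_coord) auto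

text \<open>The norm on the product is Euclidean, so a component of a pair is no longer than the pair.\<close>

lemma norm_coord_le:
  fixes z :: "nat \<Rightarrow> 'a::real_normed_vector \<times> 'b::real_normed_vector"
  assumes "j \<le> n"
  shows "(norm (fst (z j)))\<^sup>2 \<le> (\<Sum>i\<le>n. (norm (z i))\<^sup>2)"
    and "(norm (snd (z j)))\<^sup>2 \<le> (\<Sum>i\<le>n. (norm (z i))\<^sup>2)"
proof -
  have le: "(norm (z j))\<^sup>2 \<le> (\<Sum>i\<le>n. (norm (z i))\<^sup>2)"
    using assms by (intro member_le_sum) auto
  have "(norm (fst (z j)))\<^sup>2 \<le> (norm (z j))\<^sup>2" "(norm (snd (z j)))\<^sup>2 \<le> (norm (z j))\<^sup>2"
    by (cases "z j", simp add: norm_Pair)+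
  with le show "(norm (fst (z j)))\<^sup>2 \<le> (\<Sum>i\<le>n. (norm (z i))\<^sup>2)"
    and "(norm (snd (z j)))\<^sup>2 \<le> (\<Sum>i\<le>n. (norm (z i))\<^sup>2)"
    by linarith+
qed

lemma integrable_coord:
  fixes M :: "(nat \<Rightarrow> 'a::euclidean_space \<times> 'b::euclidean_space) measure"
  assumes sets: "sets M = sets (path_space n)"
    and int: "integrable M (\<lambda>z. \<Sum>i\<le>n. (norm (z i))\<^sup>2)" and j: "j \<le> n"
  shows "integrable M (\<lambda>z. (norm (fst (z j)))\<^sup>2)"
    and "integrable M (\<lambda>z. (norm (snd (z j)))\<^sup>2)"
proof -
  have [measurable]: "(\<lambda>z. fst (z j)) \<in> borel_measurable M" "(\<lambda>z. snd (z j)) \<in> borel_measurable M"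
    using j by (simp_all add: measurable_cong_sets[OF sets refl] measurable_fst_coord measurable_snd_coord)
  show "integrable M (\<lambda>z. (norm (fst (z j)))\<^sup>2)"
    using norm_coord_le(1)[OF j]
    by (intro Bochner_Integration.integrable_bound[OF int] AE_I2) (auto intro: order_trans[OF _ abs_ge_self])
  show "integrable M (\<lambda>z. (norm (snd (z j)))\<^sup>2)"
    using norm_coord_le(2)[OF j]
    by (intro Bochner_Integration.integrable_bound[OF int] AE_I2) (auto intro: order_trans[OF _ abs_ge_self])
qed

lemma marg1_in_P2:
  assumes "M \<in> P2_path n"
  shows "marg1 n M \<in> P2"
proof -
  from assms have "prob_space M" and sets: "sets M = sets (path_space n)"
    and int: "integrable M (\<lambda>z. \<Sum>i\<le>n. (norm (z i))\<^sup>2)"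
    by (auto simp: P2_path_def)
  interpret prob_space M by fact
  have [measurable]: "(\<lambda>z. fst (z n)) \<in> borel_measurable M"
    by (simp add: measurable_cong_sets[OF sets refl] measurable_fst_coord)
  have "integrable M (\<lambda>z. (norm (fst (z n)))\<^sup>2)"
    using integrable_coord(1)[OF sets int] by simp
  then show ?thesis
    by (auto simp: P2_def marg1_def integrable_distr_eq intro!: prob_space_distr)
qed

section \<open>The transition kernels\<close>

context control_model
begin

lemma K_nonneg: "0 \<le> K"
proof -
  have "0 \<le> (norm (H_map D 1 0 0 0 0))\<^sup>2"
    by simp
  also have "\<dots> \<le> K"
    using H_growth[of 1 0 0 0 0] horizon_pos by simp
  finally show ?thesis .
qed

lemma eps_measurable: "k \<in> {1..horizon D} \<Longrightarrow> eps D k \<in> borel_measurable (noise_space D)"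
  using indep_eps by (simp add: prob_space.indep_vars_def[OF prob_noise])

lemma eta_measurable: "k \<in> {1..horizon D} \<Longrightarrow> eta D k \<in> borel_measurable (noise_space D)"
  using indep_eta by (simp add: prob_space.indep_vars_def[OF prob_noise])

abbreviation obs_kernel :: "nat \<Rightarrow> 'e \<Rightarrow> 'f \<Rightarrow> 'c \<Rightarrow> 'f measure" where
  "obs_kernel k x y u \<equiv> density lborel (\<lambda>y'. ennreal (h_dens D k x y u y'))"

lemma noise_in_prob_algebra: "noise_space D \<in> space (prob_algebra (noise_space D))"
  using prob_noise by (simp add: space_prob_algebra)

text \<open>Written as an image of the noise, the observation kernel is seen to be a probability measure
  depending measurably on its parameters, and its moments follow from the growth of \<open>H\<close>.\<close>

lemma obs_kernel_eq_distr:
  assumes "k \<in> {1..horizon D}"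
  shows "obs_kernel k x y u = distr (noise_space D) borel (\<lambda>\<omega>. H_map D k x y u (eta D k \<omega>))"
proof -
  have "distr (noise_space D) lborel (\<lambda>\<omega>. H_map D k x y u (eta D k \<omega>)) = obs_kernel k x y u"
    using h_density[OF assms] by (rule distributed_distr_eq_density)
  then show ?thesis
    by (simp cong: distr_cong)
qed

lemma obs_kernel_measurable:
  assumes k: "k \<in> {1..horizon D}"
    and [measurable]: "f \<in> borel_measurable M" "g \<in> borel_measurable M" "v \<in> borel_measurable M"
  shows "(\<lambda>z. obs_kernel k (f z) (g z) (v z)) \<in> M \<rightarrow>\<^sub>M prob_algebra borel"
proof -
  note [measurable] = eta_measurable[OF k] noise_in_prob_algebra
  have "(\<lambda>(z, \<omega>). (\<lambda>(x, y, u, e). H_map D k x y u e) (f z, g z, v z, eta D k \<omega>))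
      \<in> borel_measurable (M \<Otimes>\<^sub>M noise_space D)"
    using H_measurable[OF k] by measurable
  then show ?thesis
    unfolding obs_kernel_eq_distr[OF k]
    by (intro measurable_distr_prob_space2[where M = "noise_space D"]) auto
qed

text \<open>The transition out of a given law evaluates \<open>G\<close> at one fixed measure \<open>m\<close>. This inserts a constant map
  into the Wasserstein space, so joint measurability of \<open>G\<close> leaves a Borel map of the other arguments.\<close>

lemma G_map_measurable:
  assumes k: "k \<in> {1..horizon D}" and m: "m \<in> P2"
    and [measurable]: "f \<in> borel_measurable M" "v \<in> borel_measurable M" "e \<in> borel_measurable M"
  shows "(\<lambda>z. G_map D k (f z) m (v z) (e z)) \<in> borel_measurable M"
proof -
  have "m \<in> space P2_borel"
    using m by (simp add: P2_borel_def space_measure_of_conv)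
  then have [measurable]: "(\<lambda>_. m) \<in> M \<rightarrow>\<^sub>M P2_borel"
    by simp
  have "(\<lambda>z. (\<lambda>(x, \<mu>, u, e). G_map D k x \<mu> u e) (f z, m, v z, e z)) \<in> borel_measurable M"
    using G_measurable[OF k] by measurable
  then show ?thesis
    by simp
qed

lemma hidden_kernel_measurable:
  assumes k: "k \<in> {1..horizon D}" and m: "m \<in> P2"
    and [measurable]: "f \<in> borel_measurable M" "v \<in> borel_measurable M"
  shows "(\<lambda>z. hidden_kernel D k (v z) (f z) m) \<in> M \<rightarrow>\<^sub>M prob_algebra borel"
proof -
  note [measurable] = eps_measurable[OF k] noise_in_prob_algebra G_map_measurable[OF k m]
  show ?thesis
    unfolding hidden_kernel_def
    by (intro measurable_distr_prob_space2[where M = "noise_space D"]) measurable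
qed

lemma obs_kernel_square_le:
  assumes k: "k \<in> {1..horizon D}"
  shows "(\<integral>\<^sup>+ y'. ennreal ((norm y')\<^sup>2) \<partial>obs_kernel k x y u) \<le>
    ennreal (K * (1 + (norm x)\<^sup>2 + (norm y)\<^sup>2 + (norm u)\<^sup>2
      + (\<integral>\<omega>. (norm (eta D k \<omega>))\<^sup>2 \<partial>noise_space D)))"
  unfolding obs_kernel_eq_distr[OF k]
  using distributed_measurable[OF h_density[OF k]]
  by (intro nn_integral_square_distr_le prob_noise square_eta[OF k] H_growth[OF k]) simp

lemma hidden_kernel_square_le:
  assumes k: "k \<in> {1..horizon D}" and m: "m \<in> P2"
  shows "(\<integral>\<^sup>+ x'. ennreal ((norm x')\<^sup>2) \<partial>hidden_kernel D k u x m) \<le>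
    ennreal (K * (1 + (norm x)\<^sup>2 + (W2 m (return borel 0))\<^sup>2 + (norm u)\<^sup>2
      + (\<integral>\<omega>. (norm (eps D k \<omega>))\<^sup>2 \<partial>noise_space D)))"
  unfolding hidden_kernel_def
  by (intro nn_integral_square_distr_le prob_noise square_eps[OF k] G_growth[OF k m]
      G_map_measurable[OF k m] eps_measurable[OF k]) auto

section \<open>Stability of laws with finite second moment\<close>

text \<open>The conditional law of the extended trajectory given \<open>z\<close>. The marginal \<open>m\<close> is kept as a
  parameter because it is the same for all \<open>z\<close>: the law enters the kernel
  only through \<open>m\<close>, so the transition is linear in the law once \<open>m\<close> is fixed.\<close>

abbreviation pair_kernel ::
  "nat \<Rightarrow> ((nat \<Rightarrow> 'f) \<Rightarrow> 'c) \<Rightarrow> 'e measure \<Rightarrow> (nat \<Rightarrow> 'e \<times> 'f) \<Rightarrow> (nat \<Rightarrow> 'e \<times> 'f) measure" where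
  "pair_kernel n a m z \<equiv>
    hidden_kernel D (Suc n) (a (obs n z)) (fst (z n)) m \<bind> (\<lambda>x'.
      obs_kernel (Suc n) x' (snd (z n)) (a (obs n z)) \<bind> (\<lambda>y'.
        return (path_space (Suc n)) (z(Suc n := (x', y')))))"

lemma measurable_extend_path:
  assumes [measurable]: "f \<in> N \<rightarrow>\<^sub>M path_space n" "g \<in> borel_measurable N" "h \<in> borel_measurable N"
  shows "(\<lambda>w. (f w)(Suc n := (g w, h w))) \<in> N \<rightarrow>\<^sub>M
    (path_space (Suc n) :: (nat \<Rightarrow> 'e \<times> 'f) measure)"
proof (rule measurable_fun_upd[where J = "{..n}"])
  show "(\<lambda>w. (g w, h w)) \<in> borel_measurable N"
    by (intro borel_measurable_Pair assms)
qed (auto simp: assms)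

text \<open>Values in \<^const>\<open>prob_algebra\<close> compose under the bind without leaving the probability
  measures, so one argument yields measurability and total mass one.\<close>

lemma
  assumes n: "n < horizon D" and m: "m \<in> P2" and a [measurable]: "a \<in> borel_measurable (path_space n)"
  shows obs_part_measurable:
      "(\<lambda>(z, x'). obs_kernel (Suc n) x' (snd (z n)) (a (obs n z)) \<bind> (\<lambda>y'.
        return (path_space (Suc n)) (z(Suc n := (x', y')))))
        \<in> path_space n \<Otimes>\<^sub>M borel \<rightarrow>\<^sub>M prob_algebra (path_space (Suc n))"
    and pair_kernel_measurable:
      "pair_kernel n a m \<in> path_space n \<rightarrow>\<^sub>M prob_algebra (path_space (Suc n))"
proof -
  have k: "Suc n \<in> {1..horizon D}"
    using n by simp
  note [measurable] = measurable_extend_path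
  have ret: "(\<lambda>(w, y'). return (path_space (Suc n)) ((fst w)(Suc n := (snd w, y'))))
      \<in> (path_space n \<Otimes>\<^sub>M borel) \<Otimes>\<^sub>M borel \<rightarrow>\<^sub>M
        prob_algebra (path_space (Suc n) :: (nat \<Rightarrow> 'e \<times> 'f) measure)"
    unfolding split_beta
    by (intro measurable_compose[OF _ measurable_return_prob_space]) measurable
  have "(\<lambda>w. obs_kernel (Suc n) (snd w) (snd (fst w n)) (a (obs n (fst w))))
      \<in> path_space n \<Otimes>\<^sub>M borel \<rightarrow>\<^sub>M prob_algebra borel"
    by (intro obs_kernel_measurable[OF k] measurable_snd
        measurable_compose[OF measurable_fst measurable_snd_coord]
        measurable_compose[OF measurable_fst measurable_compose[OF measurable_obs a]]) simp
  from measurable_bind_prob_space2[OF this ret]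
  show *: "(\<lambda>(z, x'). obs_kernel (Suc n) x' (snd (z n)) (a (obs n z)) \<bind> (\<lambda>y'.
      return (path_space (Suc n)) (z(Suc n := (x', y')))))
      \<in> path_space n \<Otimes>\<^sub>M borel \<rightarrow>\<^sub>M prob_algebra (path_space (Suc n))"
    by (simp add: split_beta')
  show "pair_kernel n a m \<in> path_space n \<rightarrow>\<^sub>M prob_algebra (path_space (Suc n))"
    by (intro measurable_bind_prob_space2[OF _ *] hidden_kernel_measurable[OF k m]
        measurable_fst_coord measurable_compose[OF measurable_obs a]) simp
qed

lemma nn_integral_pair_kernel:
  assumes n: "n < horizon D" and m: "m \<in> P2" and a [measurable]: "a \<in> borel_measurable (path_space n)"
    and z [measurable]: "z \<in> space (path_space n)"
    and f [measurable]: "f \<in> borel_measurable (path_space (Suc n))"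
  shows "(\<integral>\<^sup>+ w. f w \<partial>pair_kernel n a m z) =
    (\<integral>\<^sup>+ x'. \<integral>\<^sup>+ y'. f (z(Suc n := (x', y')))
      \<partial>obs_kernel (Suc n) x' (snd (z n)) (a (obs n z))
      \<partial>hidden_kernel D (Suc n) (a (obs n z)) (fst (z n)) m)"
proof -
  note [measurable] = measurable_extend_path
  have ret: "(\<lambda>y'. return (path_space (Suc n)) (z(Suc n := (x', y'))))
      \<in> borel \<rightarrow>\<^sub>M subprob_algebra (path_space (Suc n))" for x'
    by (intro measurable_compose[OF _ return_measurable]) measurable
  have obs: "(\<lambda>x'. obs_kernel (Suc n) x' (snd (z n)) (a (obs n z)) \<bind> (\<lambda>y'.
      return (path_space (Suc n)) (z(Suc n := (x', y')))))
      \<in> borel \<rightarrow>\<^sub>M subprob_algebra (path_space (Suc n))"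
    using measurable_Pair2[OF obs_part_measurable[OF n m a] z]
    by (simp add: measurable_prob_algebraD)
  have sp: "z(Suc n := (x', y')) \<in> space (path_space (Suc n))" for x' y'
    using measurable_space[OF measurable_extend_path[of "\<lambda>_. z" "count_space UNIV" n "\<lambda>_. x'" "\<lambda>_. y'"]] z
    by simp
  show ?thesis
    using sp f
    by (subst nn_integral_bind[OF f], (use obs in \<open>simp add: hidden_kernel_def cong: measurable_cong_sets\<close>)[1],
        subst nn_integral_bind[OF f], (use ret in \<open>simp cong: measurable_cong_sets\<close>)[1])
      (simp add: nn_integral_return)
qed

text \<open>Conditionally on \<open>z\<close>, the second moment of \<open>y'\<close> is at most \<open>K\<close> times an expression
  containing \<open>(norm x')\<^sup>2\<close>, which itself averages to at most a quadratic expression in \<open>z\<close>, the control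
  and the fixed distance of \<open>m\<close> from the Dirac measure at 0. The result is integrable because \<open>\<mu>\<close> has
  finite second moment and \<open>a\<close> is square integrable under \<open>\<mu>\<close>.\<close>

lemma next_law_in_P2_path:
  assumes n: "n < horizon D" and M: "\<mu> \<in> P2_path n" and a: "a \<in> controls n \<mu>"
  shows "next_law D n a \<mu> \<in> P2_path (Suc n)"
proof -
  define m where "m = marg1 n \<mu>"
  have m: "m \<in> P2"
    unfolding m_def using M by (rule marg1_in_P2)
  have k: "Suc n \<in> {1..horizon D}"
    using n by simp
  from M have "prob_space \<mu>" and sets [measurable_cong]: "sets \<mu> = sets (path_space n)"
    and int_S: "integrable \<mu> (\<lambda>z. \<Sum>i\<le>n. (norm (z i))\<^sup>2)"
    by (auto simp: P2_path_def)
  interpret prob_space \<mu> by fact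
  from a have am [measurable]: "a \<in> borel_measurable (path_space n)"
    and int_a: "integrable \<mu> (\<lambda>z. (norm (a (obs n z)))\<^sup>2)"
    by (auto simp: controls_def)
  have mu: "\<mu> \<in> space (prob_algebra (path_space n))"
    using sets \<open>prob_space \<mu>\<close> by (simp add: space_prob_algebra)
  note kernel = pair_kernel_measurable[OF n m am]
  have law: "next_law D n a \<mu> = \<mu> \<bind> pair_kernel n a m"
    by (simp add: next_law_def m_def)
  have prob: "prob_space (next_law D n a \<mu>)"
    and sets': "sets (next_law D n a \<mu>) = sets (path_space (Suc n))"
    unfolding law using prob_space_bind'[OF mu kernel] sets_bind'[OF mu kernel] .

  define S :: "nat \<Rightarrow> (nat \<Rightarrow> 'e \<times> 'f) \<Rightarrow> real" where "S = (\<lambda>n z. \<Sum>i\<le>n. (norm (z i))\<^sup>2)"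
  have S_nonneg: "0 \<le> S j z" for j z
    by (simp add: S_def sum_nonneg)
  have S_meas [measurable]: "S j \<in> borel_measurable (path_space j)" for j
    unfolding S_def by measurable
  \<comment> \<open>The factor 1 gives the sum the form \<open>b + c * (norm y')\<^sup>2\<close> of \<open>nn_integral_affine_square_le\<close>.\<close>
  have S_upd: "S (Suc n) (z(Suc n := (x', y'))) = (S n z + (norm x')\<^sup>2) + 1 * (norm y')\<^sup>2" for z x' y'
    by (simp add: S_def norm_Pair)
  define c where "c = (\<integral>\<omega>. (norm (eps D (Suc n) \<omega>))\<^sup>2 \<partial>noise_space D)"
  define d where "d = (\<integral>\<omega>. (norm (eta D (Suc n) \<omega>))\<^sup>2 \<partial>noise_space D)"
  define w where "w = W2 m (return borel 0)"
  have cd: "0 \<le> c" "0 \<le> d"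
    by (auto simp: c_def d_def)
  \<comment> \<open>\<open>B z\<close> collects what remains besides \<open>(norm x')\<^sup>2\<close> after integrating out \<open>y'\<close>, where the coefficient of
    \<open>(norm x')\<^sup>2\<close> becomes \<open>1 + K\<close>; \<open>R z\<close> is what remains after integrating out \<open>x'\<close> as well.\<close>
  define B where "B = (\<lambda>z. S n z + K * (1 + (norm (snd (z n)))\<^sup>2 + (norm (a (obs n z)))\<^sup>2 + d))"
  define R where "R = (\<lambda>z. B z
    + (1 + K) * (K * (1 + (norm (fst (z n)))\<^sup>2 + w\<^sup>2 + (norm (a (obs n z)))\<^sup>2 + c)))"
  have B_nonneg: "0 \<le> B z" for z
    using S_nonneg K_nonneg cd by (simp add: B_def)

  have bound: "(\<integral>\<^sup>+ v. ennreal (S (Suc n) v) \<partial>pair_kernel n a m z) \<le> ennreal (R z)"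
    if z: "z \<in> space (path_space n)" for z
  proof -
    let ?u = "a (obs n z)" and ?x = "fst (z n)" and ?y = "snd (z n)"
    have P: "prob_space (obs_kernel (Suc n) x' ?y ?u)" for x'
      unfolding obs_kernel_eq_distr[OF k]
      using distributed_measurable[OF h_density[OF k]] prob_noise
      by (intro prob_space.prob_space_distr) auto
    have Q: "prob_space (hidden_kernel D (Suc n) ?u ?x m)"
      unfolding hidden_kernel_def
      by (intro prob_space.prob_space_distr prob_noise G_map_measurable[OF k m]
          eps_measurable[OF k]) auto
    have "(\<integral>\<^sup>+ v. ennreal (S (Suc n) v) \<partial>pair_kernel n a m z) =
        (\<integral>\<^sup>+ x'. \<integral>\<^sup>+ y'. ennreal ((S n z + (norm x')\<^sup>2) + 1 * (norm y')\<^sup>2)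
          \<partial>obs_kernel (Suc n) x' ?y ?u \<partial>hidden_kernel D (Suc n) ?u ?x m)"
      using nn_integral_pair_kernel[OF n m am z, of "\<lambda>v. ennreal (S (Suc n) v)"]
      unfolding S_upd by simp
    also have "\<dots> \<le> (\<integral>\<^sup>+ x'. ennreal (B z + (1 + K) * (norm x')\<^sup>2)
        \<partial>hidden_kernel D (Suc n) ?u ?x m)"
    proof (rule nn_integral_mono)
      fix x'
      have "(\<integral>\<^sup>+ y'. ennreal ((S n z + (norm x')\<^sup>2) + 1 * (norm y')\<^sup>2)
            \<partial>obs_kernel (Suc n) x' ?y ?u)
          \<le> ennreal ((S n z + (norm x')\<^sup>2)
            + 1 * (K * (1 + (norm x')\<^sup>2 + (norm ?y)\<^sup>2 + (norm ?u)\<^sup>2 + d)))"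
        unfolding d_def using S_nonneg K_nonneg
        by (intro nn_integral_affine_square_le P obs_kernel_square_le[OF k]) auto
      also have "(S n z + (norm x')\<^sup>2)
            + 1 * (K * (1 + (norm x')\<^sup>2 + (norm ?y)\<^sup>2 + (norm ?u)\<^sup>2 + d))
          = B z + (1 + K) * (norm x')\<^sup>2"
        by (simp add: B_def algebra_simps)
      finally show "(\<integral>\<^sup>+ y'. ennreal ((S n z + (norm x')\<^sup>2) + 1 * (norm y')\<^sup>2)
            \<partial>obs_kernel (Suc n) x' ?y ?u) \<le> ennreal (B z + (1 + K) * (norm x')\<^sup>2)" .
    qed
    also have "\<dots> \<le> ennreal (R z)"
      unfolding R_def c_def w_def using B_nonneg K_nonneg
      by (intro nn_integral_affine_square_le Q hidden_kernel_square_le[OF k m])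
        (auto simp: hidden_kernel_def)
    finally show ?thesis .
  qed

  have int_xy: "integrable \<mu> (\<lambda>z. (norm (fst (z n)))\<^sup>2)" "integrable \<mu> (\<lambda>z. (norm (snd (z n)))\<^sup>2)"
    using integrable_coord[OF sets int_S] by simp_all
  have int_R: "integrable \<mu> R"
    unfolding R_def B_def using int_xy int_a int_S by (auto simp: S_def)
  have "(\<integral>\<^sup>+ v. ennreal (S (Suc n) v) \<partial>next_law D n a \<mu>)
      = (\<integral>\<^sup>+ z. \<integral>\<^sup>+ v. ennreal (S (Suc n) v) \<partial>pair_kernel n a m z \<partial>\<mu>)"
    unfolding law using kernel
    by (intro nn_integral_bind[where B = "path_space (Suc n)"])
      (auto simp: measurable_prob_algebraD measurable_cong_sets[OF sets refl])
  also have "\<dots> \<le> (\<integral>\<^sup>+ z. ennreal (R z) \<partial>\<mu>)"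
    by (intro nn_integral_mono bound) (simp add: sets_eq_imp_space_eq[OF sets])
  also have "\<dots> < \<infinity>"
    using integrableD(2)[OF int_R] by (simp add: less_top)
  finally have "integrable (next_law D n a \<mu>) (S (Suc n))"
    using S_nonneg S_meas[of "Suc n"]
    by (intro integrableI_nonneg) (auto simp: measurable_cong_sets[OF sets' refl])
  then show ?thesis
    using prob sets' by (simp add: P2_path_def S_def)
qed

text \<open>A feedback rule on laws with finite second moment yields an admissible control only after the
  current law is known to be of this kind; the guarded assumption makes the two facts hold in turn.\<close>

lemma flow_in_P2_path:
  assumes "\<mu> \<in> P2_path 0" and "k \<le> horizon D"
    and "\<And>j. j < k \<Longrightarrow> flow D 0 \<mu> a j \<in> P2_path j \<Longrightarrow> a j \<in> controls j (flow D 0 \<mu> a j)"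
  shows "flow D 0 \<mu> a k \<in> P2_path k"
  using assms by (induction k) (auto intro!: next_law_in_P2_path)

end

theorem mainTheorem2:
  fixes D :: "(real^'p, real^'q, real^'r, real^'d, real^'m, 'w) control_problem"
    and K :: real
  assumes "control_model D K"
  shows "(\<forall>n\<le>horizon D. \<forall>\<mu>\<in>P2_path n. W D n \<mu> = V D n \<mu>) \<and>
    (\<forall>A. (\<forall>n<horizon D. \<forall>\<mu>\<in>P2_path n. A n \<mu> \<in> controls n \<mu> \<and>
            W D n \<mu> = ereal (stage_cost D n \<mu> (A n \<mu>)) + W D (Suc n) (next_law D n (A n \<mu>) \<mu>))
      \<longrightarrow> (\<forall>\<mu>\<in>P2_path 0.
            feedback_strategy D A \<mu> \<in> admissible D 0 \<mu> \<and>
            V D 0 \<mu> = ereal (J D 0 \<mu> (feedback_strategy D A \<mu>))))"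
proof (intro conjI allI impI ballI)
  fix n and \<mu> :: "(nat \<Rightarrow> (real^'p) \<times> (real^'q)) measure"
  assume "n \<le> horizon D"
  then show "W D n \<mu> = V D n \<mu>"
    by (rule W_eq_V)
next
  interpret control_model D K by fact
  fix A and \<mu> :: "(nat \<Rightarrow> (real^'p) \<times> (real^'q)) measure"
  assume A: "\<forall>n<horizon D. \<forall>\<mu>\<in>P2_path n. A n \<mu> \<in> controls n \<mu> \<and>
      W D n \<mu> = ereal (stage_cost D n \<mu> (A n \<mu>)) + W D (Suc n) (next_law D n (A n \<mu>) \<mu>)"
    and \<mu>: "\<mu> \<in> P2_path 0"
  let ?a = "feedback_strategy D A \<mu>"
  have a: "?a n = A n (flow D 0 \<mu> ?a n)" for n
    by (rule feedback_strategy.simps)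
  have law: "flow D 0 \<mu> ?a n \<in> P2_path n" if "n \<le> horizon D" for n
    using that A by (intro flow_in_P2_path \<mu>) (auto simp: a)
  show "?a \<in> admissible D 0 \<mu>"
    unfolding admissible_def using A law a by auto
  have "W D 0 \<mu> = ereal (\<Sum>k<horizon D. stage_cost D k (flow D 0 \<mu> ?a k) (?a k))
      + W D (horizon D) (flow D 0 \<mu> ?a (horizon D))"
    using A law a by (intro W_attained_along_flow) auto
  also have "\<dots> = ereal (J D 0 \<mu> ?a)"
    by (simp add: W.simps[of D "horizon D"] J_def lessThan_atLeast0)
  finally show "V D 0 \<mu> = ereal (J D 0 \<mu> ?a)"
    by (simp add: W_eq_V)
qed

end
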